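(* Let $(G,H,\alpha,\tau)$ and $(H,J,\alpha',\tau')$ be Lie crossed modules such that $\tau'(J)$ is closed in $H$ and $\tau\tau'(J)$ is closed in $G$, let $B$ be a smooth manifold with open covering $\{U_i\}_{i\in\mathcal I}$, and let $\{h_{ik},j_{ikm}\}$ be a gerbal cocycle associated with this covering and $(H,J,\alpha',\tau')$. Put $J_H=\{(\tau'(j),\tau\tau'(j')):j,j'\in J\}$, a normal subgroup of $H\rtimes_\alpha\tau(H)$. Define $$\overline g_{ik}(u)=\tau(h_{ik}(u))\,\tau\tau'(J)\in\tau(H)/\tau\tau'(J)\qquad(u\in U_i\cap U_k),$$ $$\overline\theta_{ik}(\gamma)=\bigl(h_{ik}(\gamma_1)h_{ik}(\gamma_0)^{-1},\,\tau(h_{ik}(\gamma_0))\bigr)J_H\in\bigl(H\rtimes_\alpha\tau(H)\bigr)/J_H\qquad(\gamma\in\mathrm{Mor}(\mathbf U_{ik})).$$ Then $\{\overline g_{ik}\}$ and $\{\overline\theta_{ik}\}$ form cocycles in the traditional sense: for all $i,k,m\in\mathcal I$ with $U_i\cap U_k\cap U_m\ne\emptyset$, $$\overline g_{ik}(u)\,\overline g_{km}(u)=\overline g_{im}(u)\ \text{ for all }u\in U_i\cap U_k\cap U_m,\qquad \overline\theta_{ik}(\gamma)\,\overline\theta_{km}(\gamma)=\overline\theta_{im}(\gamma)\ \text{ for all }\gamma\in\mathrm{Mor}(\mathbf U_{ikm}).$$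
   Context: A crossed module $(G,H,\alpha,\tau)$ consists of groups $G,H$ and homomorphisms $\tau:H\to G$, $\alpha:G\to\mathrm{Aut}(H)$ with $\tau(\alpha_g(h))=g\tau(h)g^{-1}$ and $\alpha_{\tau(h)}(h')=hh'h^{-1}$. It is a Lie crossed module if $G,H$ are Lie groups and $\tau$ and $(h,g)\mapsto\alpha_g(h)$ are smooth. $H\rtimes_\alpha G$ has product $(h_2,g_2)(h_1,g_1)=(h_2\alpha_{g_2}(h_1),g_2g_1)$, and $H\rtimes_\alpha\tau(H)$ is its subgroup of elements with second component in $\tau(H)$; $\tau\tau'(J)$ is normal in $\tau(H)$. Gerbal cocycle: smooth maps $h_{ik}:U_i\cap U_k\to H$ and $j_{ikm}:U_i\cap U_k\cap U_m\to J$ (for all nonempty intersections) with $h_{im}(u)=\tau'(j_{ikm}(u))\,h_{ik}(u)\,h_{km}(u)$ for all $u\in U_i\cap U_k\cap U_m$. Path categories: $\mathbf U_{ik}$ (resp. $\mathbf U_{ikm}$) has as objects the points of $U_i\cap U_k$ (resp. $U_i\cap U_k\cap U_m$) and as morphisms the smooth paths $\gamma:[a,b]\to B$ lying in that set and constant near $a$ and $b$, modulo translation of the parameter interval. The source is $\gamma_0=\gamma(a)$ and the target is $\gamma_1=\gamma(b)$. *)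

theory Defs
  imports "HOL-Analysis.Analysis" "HOL-Algebra.Coset" "HOL-Algebra.Bij"
begin

section \<open>Smooth functions on open subsets of Euclidean space\<close>

text \<open>
  The model spaces are the spaces \<open>Euclidean_space n\<close> of the library: functions
  \<open>nat \<Rightarrow> real\<close> that vanish at all indices \<open>i \<ge> n\<close>.  Unlike a
  type of class \<open>euclidean_space\<close>, this includes \<open>n = 0\<close>, so discrete Lie
  groups are covered.
\<close>

text \<open>
  \<open>Ck_on n k S f\<close>: the real function \<open>f\<close> is of class \<open>C\<^sup>k\<close> on the set \<open>S\<close>, which is
  meant to be open in \<open>Euclidean_space n\<close> (it has continuous iterated partial derivatives up to
  order \<open>k\<close>).  Only values of \<open>f\<close> on \<open>S\<close> matter then.
\<close>
primrec Ck_on :: "nat \<Rightarrow> nat \<Rightarrow> (nat \<Rightarrow> real) set \<Rightarrow> ((nat \<Rightarrow> real) \<Rightarrow> real) \<Rightarrow> bool" where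
  "Ck_on n 0 S f \<longleftrightarrow> continuous_map (subtopology (Euclidean_space n) S) euclideanreal f"
| "Ck_on n (Suc k) S f \<longleftrightarrow>
     continuous_map (subtopology (Euclidean_space n) S) euclideanreal f \<and>
     (\<forall>i<n. \<exists>f'. (\<forall>x\<in>S. ((\<lambda>t. f (x(i := t))) has_real_derivative f' x) (at (x i))) \<and>
                 Ck_on n k S f')"

definition Cinf_on :: "nat \<Rightarrow> nat \<Rightarrow> (nat \<Rightarrow> real) set \<Rightarrow> ((nat \<Rightarrow> real) \<Rightarrow> (nat \<Rightarrow> real)) \<Rightarrow> bool" where
  "Cinf_on m n S F \<longleftrightarrow> (\<forall>j<n. \<forall>k. Ck_on m k S (\<lambda>x. F x j))"


section \<open>Smooth manifolds\<close>

text \<open>A chart is a pair of its domain and its coordinate map.\<close>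

type_synonym 'a chart = "'a set \<times> ('a \<Rightarrow> nat \<Rightarrow> real)"

record 'a mfd =
  mtop :: "'a topology"
  mdim :: nat
  atlas :: "'a chart set"

definition is_chart :: "'a topology \<Rightarrow> nat \<Rightarrow> 'a chart \<Rightarrow> bool" where
  "is_chart X n c \<longleftrightarrow> (case c of (V, \<phi>) \<Rightarrow>
     openin X V \<and> openin (Euclidean_space n) (\<phi> ` V) \<and>
     homeomorphic_map (subtopology X V) (subtopology (Euclidean_space n) (\<phi> ` V)) \<phi>)"

definition second_countable_space :: "'a topology \<Rightarrow> bool" where
  "second_countable_space X \<longleftrightarrow>
     (\<exists>\<B>. countable \<B> \<and> (\<forall>V\<in>\<B>. openin X V) \<and>
          (\<forall>W x. openin X W \<and> x \<in> W \<longrightarrow> (\<exists>V\<in>\<B>. x \<in> V \<and> V \<subseteq> W)))"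

text \<open>The atlas need not be maximal; any atlas determines the smooth structure.\<close>

definition smooth_manifold :: "'a mfd \<Rightarrow> bool" where
  "smooth_manifold M \<longleftrightarrow>
     Hausdorff_space (mtop M) \<and> second_countable_space (mtop M) \<and>
     (\<forall>c\<in>atlas M. is_chart (mtop M) (mdim M) c) \<and>
     (\<Union>c\<in>atlas M. fst c) = topspace (mtop M) \<and>
     (\<forall>(V, \<phi>)\<in>atlas M. \<forall>(W, \<psi>)\<in>atlas M.
        Cinf_on (mdim M) (mdim M) (\<phi> ` (V \<inter> W)) (\<psi> \<circ> inv_into V \<phi>))"

definition smooth_map :: "'a mfd \<Rightarrow> 'b mfd \<Rightarrow> ('a \<Rightarrow> 'b) \<Rightarrow> bool" where
  "smooth_map M N f \<longleftrightarrow>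
     continuous_map (mtop M) (mtop N) f \<and>
     (\<forall>(V, \<phi>)\<in>atlas M. \<forall>(W, \<psi>)\<in>atlas N.
        Cinf_on (mdim M) (mdim N) (\<phi> ` (V \<inter> f -` W)) (\<psi> \<circ> f \<circ> inv_into V \<phi>))"

definition open_submfd :: "'a mfd \<Rightarrow> 'a set \<Rightarrow> 'a mfd" where
  "open_submfd M W =
     \<lparr>mtop = subtopology (mtop M) W, mdim = mdim M,
      atlas = (\<lambda>(V, \<phi>). (V \<inter> W, \<phi>)) ` atlas M\<rparr>"

definition prod_mfd :: "'a mfd \<Rightarrow> 'b mfd \<Rightarrow> ('a \<times> 'b) mfd" where
  "prod_mfd M N =
     \<lparr>mtop = prod_topology (mtop M) (mtop N), mdim = mdim M + mdim N,
      atlas = {(V \<times> W, \<lambda>(x, y) i. if i < mdim M then \<phi> x i else \<psi> y (i - mdim M)) | V \<phi> W \<psi>.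
               (V, \<phi>) \<in> atlas M \<and> (W, \<psi>) \<in> atlas N}\<rparr>"

definition real_line :: "real mfd" where
  "real_line = \<lparr>mtop = euclideanreal, mdim = 1, atlas = {(UNIV, \<lambda>t i. if i = 0 then t else 0)}\<rparr>"


section \<open>Lie groups and crossed modules\<close>

record 'a lie_grp = "'a monoid" +
  mfd :: "'a mfd"

definition lie_group :: "'a lie_grp \<Rightarrow> bool" where
  "lie_group G \<longleftrightarrow>
     group G \<and> smooth_manifold (mfd G) \<and> topspace (mtop (mfd G)) = carrier G \<and>
     smooth_map (prod_mfd (mfd G) (mfd G)) (mfd G) (\<lambda>(x, y). x \<otimes>\<^bsub>G\<^esub> y) \<and>
     smooth_map (mfd G) (mfd G) (\<lambda>x. inv\<^bsub>G\<^esub> x)"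

definition crossed_module ::
  "('g, 'x) monoid_scheme \<Rightarrow> ('h, 'y) monoid_scheme \<Rightarrow> ('g \<Rightarrow> 'h \<Rightarrow> 'h) \<Rightarrow> ('h \<Rightarrow> 'g) \<Rightarrow> bool" where
  "crossed_module G H \<alpha> \<tau> \<longleftrightarrow>
     group G \<and> group H \<and> \<tau> \<in> hom H G \<and> \<alpha> \<in> hom G (AutoGroup H) \<and>
     (\<forall>g\<in>carrier G. \<forall>h\<in>carrier H. \<tau> (\<alpha> g h) = g \<otimes>\<^bsub>G\<^esub> \<tau> h \<otimes>\<^bsub>G\<^esub> inv\<^bsub>G\<^esub> g) \<and>
     (\<forall>h\<in>carrier H. \<forall>h'\<in>carrier H. \<alpha> (\<tau> h) h' = h \<otimes>\<^bsub>H\<^esub> h' \<otimes>\<^bsub>H\<^esub> inv\<^bsub>H\<^esub> h)"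

definition lie_crossed_module ::
  "'g lie_grp \<Rightarrow> 'h lie_grp \<Rightarrow> ('g \<Rightarrow> 'h \<Rightarrow> 'h) \<Rightarrow> ('h \<Rightarrow> 'g) \<Rightarrow> bool" where
  "lie_crossed_module G H \<alpha> \<tau> \<longleftrightarrow>
     crossed_module G H \<alpha> \<tau> \<and> lie_group G \<and> lie_group H \<and>
     smooth_map (mfd H) (mfd G) \<tau> \<and>
     smooth_map (prod_mfd (mfd H) (mfd G)) (mfd H) (\<lambda>(h, g). \<alpha> g h)"

definition semidirect ::
  "('h, 'y) monoid_scheme \<Rightarrow> ('g \<Rightarrow> 'h \<Rightarrow> 'h) \<Rightarrow> ('g, 'x) monoid_scheme \<Rightarrow> ('h \<times> 'g) monoid" where
  "semidirect H \<alpha> G =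
     \<lparr>carrier = carrier H \<times> carrier G,
      monoid.mult = \<lambda>(h2, g2) (h1, g1). (h2 \<otimes>\<^bsub>H\<^esub> \<alpha> g2 h1, g2 \<otimes>\<^bsub>G\<^esub> g1),
      one = (\<one>\<^bsub>H\<^esub>, \<one>\<^bsub>G\<^esub>)\<rparr>"

definition image_grp ::
  "('g, 'x) monoid_scheme \<Rightarrow> ('h, 'y) monoid_scheme \<Rightarrow> ('h \<Rightarrow> 'g) \<Rightarrow> ('g, 'x) monoid_scheme" where
  "image_grp G H \<tau> = G\<lparr>carrier := \<tau> ` carrier H\<rparr>"

definition semidirect_image ::
  "('g, 'x) monoid_scheme \<Rightarrow> ('h, 'y) monoid_scheme \<Rightarrow> ('g \<Rightarrow> 'h \<Rightarrow> 'h) \<Rightarrow> ('h \<Rightarrow> 'g) \<Rightarrow> ('h \<times> 'g) monoid" where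
  "semidirect_image G H \<alpha> \<tau> =
     (semidirect H \<alpha> G)\<lparr>carrier := {x \<in> carrier (semidirect H \<alpha> G). snd x \<in> \<tau> ` carrier H}\<rparr>"

definition JH_set :: "('j, 'z) monoid_scheme \<Rightarrow> ('h \<Rightarrow> 'g) \<Rightarrow> ('j \<Rightarrow> 'h) \<Rightarrow> ('h \<times> 'g) set" where
  "JH_set J \<tau> \<tau>' = {(\<tau>' j, \<tau> (\<tau>' j')) | j j'. j \<in> carrier J \<and> j' \<in> carrier J}"


section \<open>Gerbal cocycles\<close>

definition open_covering :: "'b mfd \<Rightarrow> 'i set \<Rightarrow> ('i \<Rightarrow> 'b set) \<Rightarrow> bool" where
  "open_covering B I U \<longleftrightarrow> (\<forall>i\<in>I. openin (mtop B) (U i)) \<and> (\<Union>i\<in>I. U i) = topspace (mtop B)"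

definition gerbal_cocycle ::
  "'b mfd \<Rightarrow> 'i set \<Rightarrow> ('i \<Rightarrow> 'b set) \<Rightarrow> 'h lie_grp \<Rightarrow> 'j lie_grp \<Rightarrow> ('j \<Rightarrow> 'h) \<Rightarrow>
   ('i \<Rightarrow> 'i \<Rightarrow> 'b \<Rightarrow> 'h) \<Rightarrow> ('i \<Rightarrow> 'i \<Rightarrow> 'i \<Rightarrow> 'b \<Rightarrow> 'j) \<Rightarrow> bool" where
  "gerbal_cocycle B I U H J \<tau>' h j \<longleftrightarrow>
     (\<forall>i\<in>I. \<forall>k\<in>I. U i \<inter> U k \<noteq> {} \<longrightarrow>
        smooth_map (open_submfd B (U i \<inter> U k)) (mfd H) (h i k)) \<and>
     (\<forall>i\<in>I. \<forall>k\<in>I. \<forall>m\<in>I. U i \<inter> U k \<inter> U m \<noteq> {} \<longrightarrow>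
        smooth_map (open_submfd B (U i \<inter> U k \<inter> U m)) (mfd J) (j i k m) \<and>
        (\<forall>u \<in> U i \<inter> U k \<inter> U m.
           h i m u = \<tau>' (j i k m u) \<otimes>\<^bsub>H\<^esub> h i k u \<otimes>\<^bsub>H\<^esub> h k m u))"


section \<open>Paths and path categories\<close>

text \<open>
  A path \<open>\<gamma> : [a,b] \<rightarrow> M\<close> is the triple \<open>(a, b, \<gamma>)\<close>, with \<open>\<gamma>\<close> undefined outside
  \<open>{a..b}\<close>.  The degenerate case \<open>a = b\<close> is included: modulo translation only,
  these paths are the identity morphisms.  Smoothness on the closed interval means that \<open>\<gamma>\<close> extends
  smoothly to a larger open interval.
\<close>

type_synonym 'b path = "real \<times> real \<times> (real \<Rightarrow> 'b)"

definition smooth_paths :: "'b mfd \<Rightarrow> 'b set \<Rightarrow> 'b path set" where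
  "smooth_paths M W = {(a, b, \<gamma>).
     a \<le> b \<and> \<gamma> \<in> extensional {a..b} \<and> \<gamma> ` {a..b} \<subseteq> W \<and>
     (\<exists>\<delta>>0. \<exists>\<gamma>'. smooth_map (open_submfd real_line {a - \<delta><..<b + \<delta>}) M \<gamma>' \<and>
                  (\<forall>t\<in>{a..b}. \<gamma>' t = \<gamma> t)) \<and>
     (\<exists>\<epsilon>>0. \<forall>t\<in>{a..b}. (t < a + \<epsilon> \<longrightarrow> \<gamma> t = \<gamma> a) \<and> (b - \<epsilon> < t \<longrightarrow> \<gamma> t = \<gamma> b))}"

definition translate_path :: "real \<Rightarrow> 'b path \<Rightarrow> 'b path" where
  "translate_path s p = (case p of (a, b, \<gamma>) \<Rightarrow> (a + s, b + s, \<lambda>t. \<gamma> (t - s)))"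

definition path_rel :: "'b mfd \<Rightarrow> 'b set \<Rightarrow> ('b path \<times> 'b path) set" where
  "path_rel M W = {(p, q). p \<in> smooth_paths M W \<and> q \<in> smooth_paths M W \<and>
                           (\<exists>s. q = translate_path s p)}"

text \<open>Morphisms of the path category whose objects are the points of \<open>W\<close>.\<close>

definition path_mor :: "'b mfd \<Rightarrow> 'b set \<Rightarrow> 'b path set set" where
  "path_mor M W = smooth_paths M W // path_rel M W"

definition path_source :: "'b path set \<Rightarrow> 'b" where
  "path_source c = (THE x. \<exists>a b \<gamma>. (a, b, \<gamma>) \<in> c \<and> x = \<gamma> a)"

definition path_target :: "'b path set \<Rightarrow> 'b" where
  "path_target c = (THE x. \<exists>a b \<gamma>. (a, b, \<gamma>) \<in> c \<and> x = \<gamma> b)"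


section \<open>The reduced cocycles\<close>

text \<open>Elements of the factor groups are written as left cosets \<open>x N\<close>.\<close>

definition g_bar ::
  "('g, 'x) monoid_scheme \<Rightarrow> ('j, 'z) monoid_scheme \<Rightarrow> ('h \<Rightarrow> 'g) \<Rightarrow> ('j \<Rightarrow> 'h) \<Rightarrow>
   ('i \<Rightarrow> 'i \<Rightarrow> 'b \<Rightarrow> 'h) \<Rightarrow> 'i \<Rightarrow> 'i \<Rightarrow> 'b \<Rightarrow> 'g set" where
  "g_bar G J \<tau> \<tau>' h i k u = \<tau> (h i k u) <#\<^bsub>G\<^esub> (\<tau> ` \<tau>' ` carrier J)"

definition theta_bar ::
  "('g, 'x) monoid_scheme \<Rightarrow> ('h, 'y) monoid_scheme \<Rightarrow> ('j, 'z) monoid_scheme \<Rightarrow>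
   ('g \<Rightarrow> 'h \<Rightarrow> 'h) \<Rightarrow> ('h \<Rightarrow> 'g) \<Rightarrow> ('j \<Rightarrow> 'h) \<Rightarrow>
   ('i \<Rightarrow> 'i \<Rightarrow> 'b \<Rightarrow> 'h) \<Rightarrow> 'i \<Rightarrow> 'i \<Rightarrow> 'b path set \<Rightarrow> ('h \<times> 'g) set" where
  "theta_bar G H J \<alpha> \<tau> \<tau>' h i k c =
     (h i k (path_target c) \<otimes>\<^bsub>H\<^esub> inv\<^bsub>H\<^esub> h i k (path_source c), \<tau> (h i k (path_source c)))
       <#\<^bsub>semidirect_image G H \<alpha> \<tau>\<^esub> JH_set J \<tau> \<tau>'"

end

theory Submission
  imports Defs
begin

text \<open>
  Let \<open>N = \<tau>'(J)\<close>, which the Peiffer-type identities make normal in \<open>H\<close>.  Since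
  \<open>\<alpha>\<close> restricted to \<open>\<tau>(H)\<close> is conjugation in \<open>H\<close>, the map
  \<open>(y\<^sub>1, y\<^sub>0) \<mapsto> (y\<^sub>1 y\<^sub>0\<inverse>, \<tau> y\<^sub>0)\<close> is a surjective homomorphism from \<open>H \<times> H\<close>
  onto \<open>H \<rtimes> \<tau>(H)\<close>, and it maps \<open>N \<times> N\<close> onto \<open>J\<^sub>H\<close>.  It sends the pair of
  values of \<open>h\<^sub>i\<^sub>k\<close> at the target and the source of a path to the representative of
  \<open>\<theta>\<^sub>i\<^sub>k\<close>.  So both claims are images, under \<open>\<tau>\<close> and under this map, of the fact that \<open>h\<close>
  is multiplicative modulo \<open>N\<close>.
\<close>

text \<open>All of \<open>S\<close> is the image of \<open>K\<close>, so it inherits the group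
  axioms through \<open>f\<close>; the unit is prescribed because membership in \<open>hom\<close>
  says nothing about the field \<open>one\<close>. The factor \<open>n\<close> becomes invisible
  because \<open>f n\<close> lies in the image of \<open>M\<close>, the normal subgroup that is
  divided out.\<close>

lemma coset_mult_surj_hom_image:
  assumes "M \<lhd> K" and f: "f \<in> hom K S" and surj: "f ` carrier K = carrier S"
    and one: "f \<one>\<^bsub>K\<^esub> = \<one>\<^bsub>S\<^esub>"
  shows "f ` M \<lhd> S"
    and "x \<in> carrier K \<Longrightarrow> f x <#\<^bsub>S\<^esub> f ` M \<in> carrier (S Mod f ` M)"
    and "\<lbrakk>x \<in> carrier K; y \<in> carrier K; n \<in> M\<rbrakk> \<Longrightarrow>
      (f x <#\<^bsub>S\<^esub> f ` M) \<otimes>\<^bsub>S Mod f ` M\<^esub> (f y <#\<^bsub>S\<^esub> f ` M) = f (n \<otimes>\<^bsub>K\<^esub> x \<otimes>\<^bsub>K\<^esub> y) <#\<^bsub>S\<^esub> f ` M"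
proof -
  interpret M: normal M K by fact
  have "S\<lparr>carrier := f ` carrier K, one := f \<one>\<^bsub>K\<^esub>\<rparr> = S"
    using surj one by simp
  then have "group S"
    using M.hom_imp_img_group[OF f] by simp
  then interpret S: group S .
  interpret f: group_hom K S f
    by unfold_locales (rule f)
  show normal: "f ` M \<lhd> S"
    using M.surj_hom_normal_subgroup[OF f.group_hom_axioms surj] .
  then interpret fM: normal "f ` M" S .
  \<comment> \<open>The factor group \<open>Mod\<close> is built from right cosets, the cocycles
    from left ones; normality identifies the two.\<close>
  have lr: "z <#\<^bsub>S\<^esub> f ` M = f ` M #>\<^bsub>S\<^esub> z" if "z \<in> carrier S" for z
    using fM.coset_eq that by simp
  show "f x <#\<^bsub>S\<^esub> f ` M \<in> carrier (S Mod f ` M)" if "x \<in> carrier K"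
    using that by (auto simp: lr FactGroup_def RCOSETS_def)
  assume x: "x \<in> carrier K" and y: "y \<in> carrier K" and n: "n \<in> M"
  have nK: "n \<in> carrier K" using n by (rule M.mem_carrier)
  have "f ` M #>\<^bsub>S\<^esub> f n = f ` M"
    using n by (intro S.coset_join2) (auto simp: fM.subgroup_axioms nK)
  then have "f ` M #>\<^bsub>S\<^esub> f (n \<otimes>\<^bsub>K\<^esub> x \<otimes>\<^bsub>K\<^esub> y) = f ` M #>\<^bsub>S\<^esub> (f x \<otimes>\<^bsub>S\<^esub> f y)"
    using x y nK by (simp add: S.m_assoc S.coset_mult_assoc[symmetric] fM.subset)
  then show "(f x <#\<^bsub>S\<^esub> f ` M) \<otimes>\<^bsub>S Mod f ` M\<^esub> (f y <#\<^bsub>S\<^esub> f ` M) = f (n \<otimes>\<^bsub>K\<^esub> x \<otimes>\<^bsub>K\<^esub> y) <#\<^bsub>S\<^esub> f ` M"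
    using x y nK by (simp add: lr fM.rcos_sum)
qed

text \<open>Equivariance writes the conjugate of \<open>\<tau> y\<close> by \<open>x\<close> as
  \<open>\<tau> (\<alpha> x y)\<close>, again a value of \<tau>.\<close>

lemma crossed_module_image_normal:
  assumes "crossed_module H J \<alpha> \<tau>"
  shows "\<tau> ` carrier J \<lhd> H"
proof -
  interpret H: group H using assms by (simp add: crossed_module_def)
  interpret J: group J using assms by (simp add: crossed_module_def)
  interpret \<tau>: group_hom J H \<tau>
    using assms by unfold_locales (simp add: crossed_module_def)
  have "x \<otimes>\<^bsub>H\<^esub> \<tau> y \<otimes>\<^bsub>H\<^esub> inv\<^bsub>H\<^esub> x \<in> \<tau> ` carrier J" if x: "x \<in> carrier H" and y: "y \<in> carrier J" for x y
  proof -
    have "\<alpha> x \<in> hom J J"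
      using assms x by (auto simp: crossed_module_def hom_def AutoGroup_def auto_def)
    then have "\<alpha> x y \<in> carrier J" using y by (auto simp: hom_def)
    moreover have "\<tau> (\<alpha> x y) = x \<otimes>\<^bsub>H\<^esub> \<tau> y \<otimes>\<^bsub>H\<^esub> inv\<^bsub>H\<^esub> x"
      using assms x y by (simp add: crossed_module_def)
    ultimately show ?thesis by (metis imageI)
  qed
  then show ?thesis
    using \<tau>.img_is_subgroup by (auto simp: H.normal_inv_iff)
qed

text \<open>For a Lie group the underlying space is the carrier, so continuity is what places the
  values of \<open>h\<close> and \<open>j\<close> in the groups.\<close>

lemma smooth_map_open_submfd_in_topspace:
  assumes "smooth_map (open_submfd B W) M f" and "openin (mtop B) W" and "u \<in> W"
  shows "f u \<in> topspace (mtop M)"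
proof -
  have "u \<in> topspace (subtopology (mtop B) W)"
    using assms(2,3) openin_subset by fastforce
  moreover have "continuous_map (subtopology (mtop B) W) (mtop M) f"
    using assms(1) by (simp add: smooth_map_def open_submfd_def)
  ultimately show ?thesis
    by (auto simp: continuous_map_def)
qed

text \<open>A translation shifts the interval and the parameter together, so all representatives
  share their endpoint values and both definite descriptions are well defined.\<close>

lemma path_mor_endpoints:
  assumes "c \<in> path_mor B W"
  shows "path_source c \<in> W" and "path_target c \<in> W"
proof -
  obtain a b \<gamma> where p: "(a, b, \<gamma>) \<in> smooth_paths B W" and c: "c = path_rel B W `` {(a, b, \<gamma>)}"
    using assms unfolding path_mor_def by (metis prod_cases3 quotientE)
  have ab: "a \<le> b" "\<gamma> ` {a..b} \<subseteq> W"
    using p unfolding smooth_paths_def mem_Collect_eq prod.case by iprover+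
  \<comment> \<open>The zero translation puts the chosen representative into its own class.\<close>
  have "translate_path 0 (a, b, \<gamma>) = (a, b, \<gamma>)"
    by (simp add: translate_path_def)
  then have mem: "(a, b, \<gamma>) \<in> c"
    using p unfolding c path_rel_def Image_singleton_iff mem_Collect_eq prod.case by metis
  have ends: "\<gamma>' a' = \<gamma> a" "\<gamma>' b' = \<gamma> b" if "(a', b', \<gamma>') \<in> c" for a' b' \<gamma>'
  proof -
    obtain t where "(a', b', \<gamma>') = translate_path t (a, b, \<gamma>)"
      using \<open>(a', b', \<gamma>') \<in> c\<close> by (auto simp only: c path_rel_def Image_singleton_iff mem_Collect_eq prod.case)
    then show "\<gamma>' a' = \<gamma> a" "\<gamma>' b' = \<gamma> b"
      by (simp_all add: translate_path_def)
  qed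
  have "path_source c = \<gamma> a"
    unfolding path_source_def
  proof (rule the_equality)
    show "\<exists>a' b' \<gamma>'. (a', b', \<gamma>') \<in> c \<and> \<gamma> a = \<gamma>' a'"
      using mem by blast
  qed (metis ends(1))
  moreover have "path_target c = \<gamma> b"
    unfolding path_target_def
  proof (rule the_equality)
    show "\<exists>a' b' \<gamma>'. (a', b', \<gamma>') \<in> c \<and> \<gamma> b = \<gamma>' b'"
      using mem by blast
  qed (metis ends(2))
  moreover have "\<gamma> a \<in> W" "\<gamma> b \<in> W"
    using ab by (simp_all add: image_subset_iff)
  ultimately show "path_source c \<in> W" "path_target c \<in> W" by simp_all
qed

text \<open>With the Peiffer identity, the first component of a product of images is
  \<open>y1 y0^-1 (y0 z1 z0^-1 y0^-1) = (y1 z1) (y0 z0)^-1\<close>, so \<open>f\<close> is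
  multiplicative. A preimage of \<open>(x, \<tau> y)\<close> is \<open>(x y, y)\<close>.\<close>

lemma crossed_module_pair_hom:
  fixes G :: "('g, 'x) monoid_scheme" and H :: "('h, 'y) monoid_scheme"
  assumes cm: "crossed_module G H \<alpha> \<tau>"
  defines "f \<equiv> \<lambda>(y1, y0). (y1 \<otimes>\<^bsub>H\<^esub> inv\<^bsub>H\<^esub> y0, \<tau> y0)"
  shows "f \<in> hom (H \<times>\<times> H) (semidirect_image G H \<alpha> \<tau>)"
    and "f ` carrier (H \<times>\<times> H) = carrier (semidirect_image G H \<alpha> \<tau>)"
    and "f \<one>\<^bsub>H \<times>\<times> H\<^esub> = \<one>\<^bsub>semidirect_image G H \<alpha> \<tau>\<^esub>"
    and "subgroup (\<tau>' ` carrier J) H \<Longrightarrow> f ` (\<tau>' ` carrier J \<times> \<tau>' ` carrier J) = JH_set J \<tau> \<tau>'"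
proof -
  interpret G: group G using cm by (simp add: crossed_module_def)
  interpret H: group H using cm by (simp add: crossed_module_def)
  interpret \<tau>: group_hom H G \<tau>
    using cm by unfold_locales (simp add: crossed_module_def)
  have \<alpha>: "\<alpha> (\<tau> x) y = x \<otimes>\<^bsub>H\<^esub> y \<otimes>\<^bsub>H\<^esub> inv\<^bsub>H\<^esub> x" if "x \<in> carrier H" "y \<in> carrier H" for x y
    using cm that by (simp add: crossed_module_def)
  have cancel: "inv\<^bsub>H\<^esub> x \<otimes>\<^bsub>H\<^esub> (x \<otimes>\<^bsub>H\<^esub> y) = y" if "x \<in> carrier H" "y \<in> carrier H" for x y
    using that by (simp flip: H.m_assoc)
  show "f \<in> hom (H \<times>\<times> H) (semidirect_image G H \<alpha> \<tau>)"
    by (rule homI)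
      (auto simp: f_def semidirect_image_def semidirect_def \<alpha> H.m_assoc H.inv_mult_group cancel)
  show "f ` carrier (H \<times>\<times> H) = carrier (semidirect_image G H \<alpha> \<tau>)"
  proof (intro equalityI subsetI)
    fix z assume "z \<in> carrier (semidirect_image G H \<alpha> \<tau>)"
    then obtain x y where z: "z = (x, \<tau> y)" "x \<in> carrier H" "y \<in> carrier H"
      by (auto simp: semidirect_image_def semidirect_def)
    then have "z = f (x \<otimes>\<^bsub>H\<^esub> y, y)"
      by (simp add: f_def H.m_assoc)
    then show "z \<in> f ` carrier (H \<times>\<times> H)"
      using z by auto
  qed (auto simp: f_def semidirect_image_def semidirect_def)
  show "f \<one>\<^bsub>H \<times>\<times> H\<^esub> = \<one>\<^bsub>semidirect_image G H \<alpha> \<tau>\<^esub>"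
    by (simp add: f_def semidirect_image_def semidirect_def)
  assume "subgroup (\<tau>' ` carrier J) H"
  then interpret N: subgroup "\<tau>' ` carrier J" H .
  \<comment> \<open>The two parameters of \<open>JH_set\<close> vary independently, so it is a full
    product.\<close>
  have JH: "JH_set J \<tau> \<tau>' = \<tau>' ` carrier J \<times> \<tau> ` \<tau>' ` carrier J"
    by (auto simp: JH_set_def)
  show "f ` (\<tau>' ` carrier J \<times> \<tau>' ` carrier J) = JH_set J \<tau> \<tau>'"
    unfolding JH
  proof (intro equalityI subsetI)
    fix z assume "z \<in> \<tau>' ` carrier J \<times> \<tau> ` \<tau>' ` carrier J"
    then obtain x y where z: "z = (x, \<tau> y)" and x: "x \<in> \<tau>' ` carrier J" and y: "y \<in> \<tau>' ` carrier J"
      by blast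
    \<comment> \<open>The same preimage as for surjectivity; closure under products keeps it inside
      the subgroup.\<close>
    then have "z = f (x \<otimes>\<^bsub>H\<^esub> y, y)"
      using N.mem_carrier[OF x] N.mem_carrier[OF y] by (simp add: f_def H.m_assoc)
    then show "z \<in> f ` (\<tau>' ` carrier J \<times> \<tau>' ` carrier J)"
      using N.m_closed[OF x y] y by blast
  next
    fix z assume "z \<in> f ` (\<tau>' ` carrier J \<times> \<tau>' ` carrier J)"
    then obtain x y where z: "z = f (x, y)" and x: "x \<in> \<tau>' ` carrier J" and y: "y \<in> \<tau>' ` carrier J"
      by blast
    then show "z \<in> \<tau>' ` carrier J \<times> \<tau> ` \<tau>' ` carrier J"
      using N.m_closed[OF x N.m_inv_closed[OF y]] by (simp add: f_def)
  qed
qed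

theorem mainTheorem7:
  fixes G :: "'g lie_grp" and H :: "'h lie_grp" and J :: "'j lie_grp"
    and \<alpha> :: "'g \<Rightarrow> 'h \<Rightarrow> 'h" and \<tau> :: "'h \<Rightarrow> 'g"
    and \<alpha>' :: "'h \<Rightarrow> 'j \<Rightarrow> 'j" and \<tau>' :: "'j \<Rightarrow> 'h"
    and B :: "'b mfd" and I :: "'i set" and U :: "'i \<Rightarrow> 'b set"
    and h :: "'i \<Rightarrow> 'i \<Rightarrow> 'b \<Rightarrow> 'h" and j :: "'i \<Rightarrow> 'i \<Rightarrow> 'i \<Rightarrow> 'b \<Rightarrow> 'j"
  assumes "lie_crossed_module G H \<alpha> \<tau>"
    and "lie_crossed_module H J \<alpha>' \<tau>'"
    and "closedin (mtop (mfd H)) (\<tau>' ` carrier J)"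
    and "closedin (mtop (mfd G)) (\<tau> ` \<tau>' ` carrier J)"
    and "smooth_manifold B"
    and "open_covering B I U"
    and "gerbal_cocycle B I U H J \<tau>' h j"
  shows "\<tau> ` \<tau>' ` carrier J \<lhd> image_grp G H \<tau> \<and>
    JH_set J \<tau> \<tau>' \<lhd> semidirect_image G H \<alpha> \<tau> \<and>
    (\<forall>i\<in>I. \<forall>k\<in>I. \<forall>u \<in> U i \<inter> U k.
       g_bar G J \<tau> \<tau>' h i k u \<in> carrier (image_grp G H \<tau> Mod (\<tau> ` \<tau>' ` carrier J))) \<and>
    (\<forall>i\<in>I. \<forall>k\<in>I. \<forall>c \<in> path_mor B (U i \<inter> U k).
       theta_bar G H J \<alpha> \<tau> \<tau>' h i k c
         \<in> carrier (semidirect_image G H \<alpha> \<tau> Mod JH_set J \<tau> \<tau>')) \<and>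
    (\<forall>i\<in>I. \<forall>k\<in>I. \<forall>m\<in>I. U i \<inter> U k \<inter> U m \<noteq> {} \<longrightarrow>
       (\<forall>u \<in> U i \<inter> U k \<inter> U m.
          g_bar G J \<tau> \<tau>' h i k u
            \<otimes>\<^bsub>image_grp G H \<tau> Mod (\<tau> ` \<tau>' ` carrier J)\<^esub> g_bar G J \<tau> \<tau>' h k m u
          = g_bar G J \<tau> \<tau>' h i m u) \<and>
       (\<forall>c \<in> path_mor B (U i \<inter> U k \<inter> U m).
          theta_bar G H J \<alpha> \<tau> \<tau>' h i k c
            \<otimes>\<^bsub>semidirect_image G H \<alpha> \<tau> Mod JH_set J \<tau> \<tau>'\<^esub> theta_bar G H J \<alpha> \<tau> \<tau>' h k m c
          = theta_bar G H J \<alpha> \<tau> \<tau>' h i m c))"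
proof -
  define N where "N = \<tau>' ` carrier J"
  define f where "f = (\<lambda>(y1, y0). (y1 \<otimes>\<^bsub>H\<^esub> inv\<^bsub>H\<^esub> y0, \<tau> y0))"
  have cm: "crossed_module G H \<alpha> \<tau>" and cm': "crossed_module H J \<alpha>' \<tau>'"
    using assms(1,2) by (simp_all add: lie_crossed_module_def)
  have HJ: "lie_group H" "lie_group J"
    using assms(2) by (simp_all add: lie_crossed_module_def)
  interpret H: group H using HJ(1) by (simp add: lie_group_def)
  have N: "N \<lhd> H"
    unfolding N_def by (rule crossed_module_image_normal[OF cm'])
  interpret N: normal N H by (rule N)
  have \<tau>: "\<tau> \<in> hom H (image_grp G H \<tau>)" "\<tau> ` carrier H = carrier (image_grp G H \<tau>)"
    "\<tau> \<one>\<^bsub>H\<^esub> = \<one>\<^bsub>image_grp G H \<tau>\<^esub>"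
    using cm hom_one[of \<tau> H G] by (auto simp: crossed_module_def image_grp_def hom_def)
  note f = crossed_module_pair_hom(1-3)[OF cm, folded f_def]
  have JH: "f ` (N \<times> N) = JH_set J \<tau> \<tau>'"
    unfolding f_def N_def
    by (rule crossed_module_pair_hom(4)[OF cm]) (rule N.subgroup_axioms[unfolded N_def])
  note g_coset = coset_mult_surj_hom_image[OF N \<tau>]
  \<comment> \<open>Here the coset lemma is used for the product of \<open>N\<close> with itself in
    the direct square of \<open>H\<close>; pairs list the target value first, then the source
    value.\<close>
  note \<theta>_coset = coset_mult_surj_hom_image[OF H.DirProd_normal[OF H.group_axioms N N] f, unfolded JH]
  \<comment> \<open>A left coset depends only on the multiplication, which \<open>image_grp\<close>
    takes over from \<open>G\<close>.\<close>
  have g_bar: "g_bar G J \<tau> \<tau>' h i k u = \<tau> (h i k u) <#\<^bsub>image_grp G H \<tau>\<^esub> \<tau> ` N" for i k u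
    by (simp add: g_bar_def N_def image_grp_def l_coset_def)
  have theta_bar: "theta_bar G H J \<alpha> \<tau> \<tau>' h i k c
      = f (h i k (path_target c), h i k (path_source c)) <#\<^bsub>semidirect_image G H \<alpha> \<tau>\<^esub> JH_set J \<tau> \<tau>'" for i k c
    by (simp add: theta_bar_def f_def)
  have openU: "openin (mtop B) (U i)" if "i \<in> I" for i
    using assms(6) that by (simp add: open_covering_def)
  have hH: "h i k u \<in> carrier H" if ik: "i \<in> I" "k \<in> I" and u: "u \<in> U i \<inter> U k" for i k u
  proof -
    \<comment> \<open>The point \<open>u\<close> itself shows that the overlap is nonempty, as the
      cocycle conditions require.\<close>
    have "smooth_map (open_submfd B (U i \<inter> U k)) (mfd H) (h i k)"
      using assms(7) ik u by (auto simp: gerbal_cocycle_def)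
    from smooth_map_open_submfd_in_topspace[OF this _ u] show ?thesis
      using openU ik HJ(1) by (simp add: openin_Int lie_group_def)
  qed
  \<comment> \<open>All that is kept of \<open>j\<close> is that it supplies a correction factor in
    \<open>N\<close> at each point.\<close>
  have cocycle: "\<exists>n\<in>N. h i m u = n \<otimes>\<^bsub>H\<^esub> h i k u \<otimes>\<^bsub>H\<^esub> h k m u"
    if ikm: "i \<in> I" "k \<in> I" "m \<in> I" and u: "u \<in> U i \<inter> U k \<inter> U m" for i k m u
  proof -
    have *: "smooth_map (open_submfd B (U i \<inter> U k \<inter> U m)) (mfd J) (j i k m)"
      "h i m u = \<tau>' (j i k m u) \<otimes>\<^bsub>H\<^esub> h i k u \<otimes>\<^bsub>H\<^esub> h k m u"
      using assms(7) ikm u unfolding gerbal_cocycle_def by blast+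
    from smooth_map_open_submfd_in_topspace[OF *(1) _ u] have "j i k m u \<in> carrier J"
      using openU ikm HJ(2) by (simp add: openin_Int lie_group_def)
    then show ?thesis using *(2) by (auto simp: N_def)
  qed
  have g_mult: "g_bar G J \<tau> \<tau>' h i k u
      \<otimes>\<^bsub>image_grp G H \<tau> Mod (\<tau> ` N)\<^esub> g_bar G J \<tau> \<tau>' h k m u = g_bar G J \<tau> \<tau>' h i m u"
    if ikm: "i \<in> I" "k \<in> I" "m \<in> I" and u: "u \<in> U i \<inter> U k \<inter> U m" for i k m u
  proof -
    obtain n where "n \<in> N" "h i m u = n \<otimes>\<^bsub>H\<^esub> h i k u \<otimes>\<^bsub>H\<^esub> h k m u"
      using cocycle[OF ikm u] by blast
    then show ?thesis
      unfolding g_bar using g_coset(3)[of "h i k u" "h k m u" n] hH ikm u by simp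
  qed
  have \<theta>_mult: "theta_bar G H J \<alpha> \<tau> \<tau>' h i k c
      \<otimes>\<^bsub>semidirect_image G H \<alpha> \<tau> Mod JH_set J \<tau> \<tau>'\<^esub> theta_bar G H J \<alpha> \<tau> \<tau>' h k m c
      = theta_bar G H J \<alpha> \<tau> \<tau>' h i m c"
    if ikm: "i \<in> I" "k \<in> I" "m \<in> I" and c: "c \<in> path_mor B (U i \<inter> U k \<inter> U m)" for i k m c
  proof -
    let ?s = "path_source c" and ?t = "path_target c"
    note ends = path_mor_endpoints[OF c]
    \<comment> \<open>The corrections at the source and at the target are unrelated;
      \<open>JH_set\<close> absorbs them as an independent pair.\<close>
    obtain n0 n1 where n: "n0 \<in> N" "n1 \<in> N"
      and eq: "h i m ?s = n0 \<otimes>\<^bsub>H\<^esub> h i k ?s \<otimes>\<^bsub>H\<^esub> h k m ?s"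
        "h i m ?t = n1 \<otimes>\<^bsub>H\<^esub> h i k ?t \<otimes>\<^bsub>H\<^esub> h k m ?t"
      using cocycle[OF ikm] ends by meson
    have "(h i k ?t, h i k ?s) \<in> carrier (H \<times>\<times> H)" "(h k m ?t, h k m ?s) \<in> carrier (H \<times>\<times> H)"
      using hH ikm ends by auto
    from \<theta>_coset(3)[OF this, of "(n1, n0)"] n eq show ?thesis
      unfolding theta_bar by simp
  qed
  have g_mem: "g_bar G J \<tau> \<tau>' h i k u \<in> carrier (image_grp G H \<tau> Mod (\<tau> ` N))"
    if "i \<in> I" "k \<in> I" "u \<in> U i \<inter> U k" for i k u
    unfolding g_bar using g_coset(2) hH that by blast
  have \<theta>_mem: "theta_bar G H J \<alpha> \<tau> \<tau>' h i k c \<in> carrier (semidirect_image G H \<alpha> \<tau> Mod JH_set J \<tau> \<tau>')"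
    if "i \<in> I" "k \<in> I" "c \<in> path_mor B (U i \<inter> U k)" for i k c
    unfolding theta_bar using \<theta>_coset(2) hH that path_mor_endpoints[OF that(3)] by auto
  show ?thesis
    unfolding N_def[symmetric]
    by (intro conjI ballI impI g_coset(1) \<theta>_coset(1) g_mem \<theta>_mem g_mult \<theta>_mult)
qed

end
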